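(* Let $\{\mathbf X_t\}=\{(X_{1,t},X_{2,t})^T\}$ be a BRCMNBINAR(1) process with parameters $m_1,m_2,l$ and innovation joint probability mass function $f_{\mathbf Z}$, i.e. $X_{i,t}=\alpha_{i,t}\diamond X_{i,t-1}+Z_{i,t}$, $i=1,2$, $t\in\mathbb N$. Then $\{\mathbf X_t\}$ is a Markov process on $\mathbb N_0^2$ with transition probabilities, for $\mathbf x_t=(x_{1,t},x_{2,t})^T$ and $\mathbf x_{t-1}=(x_{1,t-1},x_{2,t-1})^T$ in $\mathbb N_0^2$, $$P(\mathbf X_t=\mathbf x_t\mid \mathbf X_{t-1}=\mathbf x_{t-1})=\sum_{k=0}^{x_{1,t}}\sum_{s=0}^{x_{2,t}}f_{\mathbf Z}(x_{1,t}-k,x_{2,t}-s)\binom{x_{1,t-1}+k}{k}\frac{\Gamma(x_{1,t-1}+l+2)\Gamma(k+m_1)\Gamma(l+m_1+1)}{\Gamma(x_{1,t-1}+k+m_1+l+2)\Gamma(l+1)\Gamma(m_1)}\binom{x_{2,t-1}+s}{s}\frac{\Gamma(x_{2,t-1}+l+2)\Gamma(s+m_2)\Gamma(l+m_2+1)}{\Gamma(x_{2,t-1}+s+m_2+l+2)\Gamma(l+1)\Gamma(m_2)}.$$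
   Context: $\mathbb N_0=\{0,1,2,\dots\}$. Modified negative binomial operator: for $\alpha>0$ and an $\mathbb N_0$-valued random variable $X$, $\alpha\diamond X=\sum_{j=1}^{X+1}G_j$, where $\{G_j\}$ are i.i.d. geometric with parameter $\frac{\alpha}{1+\alpha}$, i.e. $P(G_j=k)=\frac{\alpha^k}{(1+\alpha)^{k+1}}$, $k\in\mathbb N_0$ (mean $\alpha$), independent of $X$. When $\alpha$ is random, this is understood conditionally on $\alpha$. BRCMNBINAR(1) process: an $\mathbb N_0^2$-valued process $\mathbf X_t=(X_{1,t},X_{2,t})^T$ with $X_{i,t}=\alpha_{i,t}\diamond X_{i,t-1}+Z_{i,t}$, $i=1,2$, $t\in\mathbb N$, where: (i) for $i=1,2$, $\{\alpha_{i,t}\}_t$ is i.i.d. Beta prime with density $f(x)=x^{m_i-1}(1+x)^{-m_i-l-1}/B(m_i,l+1)$, $x>0$ ($B$ is the Beta function), where $l>1$ is a known constant and $0<m_i<l$; so $E(\alpha_{i,t})=\alpha_i=m_i/l$ and $\mathrm{Var}(\alpha_{i,t})=\sigma_{\alpha_i}^2=\frac{m_i(m_i+l)}{(l-1)l^2}$; $\{\alpha_{1,t}\}$ and $\{\alpha_{2,t}\}$ are mutually independent; (ii) $\mathbf Z_t=(Z_{1,t},Z_{2,t})^T$ are i.i.d. $\mathbb N_0^2$-valued random vectors with joint pmf $f_{\mathbf Z}(x,y)$, $E(Z_{i,t})=\mu_i$, $\mathrm{Var}(Z_{i,t})=\sigma_{Z_i}^2<\infty$, $\mathrm{Cov}(Z_{1,t},Z_{2,t})=\phi$;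 $\mathbf Z_t$ is independent of $(\alpha_{1,t}\diamond X_{1,t-1},\alpha_{2,t}\diamond X_{2,t-1})$ and of $\mathbf X_s$ for $s<t$; (iii) given the coefficients $\alpha_{i,t}$, the counting variables $G_j$ used in different components $i$ and at different times $t$ are independent; the triples (coefficients $(\alpha_{1,t},\alpha_{2,t})$, counting variables at time $t$, $\mathbf Z_t$) are independent over $t$ and independent of $\mathbf X_s$, $s<t$; (iv) $(m_1,\mu_1)\neq(m_2,\mu_2)$. *)

theory Defs
  imports "HOL-Probability.Probability"
begin

(* The library constant indep_var forces both variables to have the same codomain type; this is
   its heterogeneous version (cf. the library fact indep_var_eq). *)
definition indep_rv ::
  "'a measure \<Rightarrow> 'b measure \<Rightarrow> ('a \<Rightarrow> 'b) \<Rightarrow> 'c measure \<Rightarrow> ('a \<Rightarrow> 'c) \<Rightarrow> bool" where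
  "indep_rv M N X K Y \<longleftrightarrow>
     X \<in> measurable M N \<and> Y \<in> measurable M K \<and>
     prob_space.indep_set M {X -` A \<inter> space M |A. A \<in> sets N} {Y -` B \<inter> space M |B. B \<in> sets K}"

definition cond_prob_sigma :: "'a measure \<Rightarrow> 'a measure \<Rightarrow> ('a \<Rightarrow> bool) \<Rightarrow> 'a \<Rightarrow> real" where
  "cond_prob_sigma M F P = real_cond_exp M F (indicator {\<omega> \<in> space M. P \<omega>})"

definition cond_indep_vars ::
  "'a measure \<Rightarrow> 'a measure \<Rightarrow> ('i \<Rightarrow> 'b measure) \<Rightarrow> ('i \<Rightarrow> 'a \<Rightarrow> 'b) \<Rightarrow> 'i set \<Rightarrow> bool" where
  "cond_indep_vars M F N Y I \<longleftrightarrow>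
     (\<forall>i\<in>I. Y i \<in> measurable M (N i)) \<and>
     (\<forall>J A. J \<subseteq> I \<and> finite J \<and> (\<forall>j\<in>J. A j \<in> sets (N j)) \<longrightarrow>
        (AE \<omega> in M. cond_prob_sigma M F (\<lambda>\<omega>'. \<forall>j\<in>J. Y j \<omega>' \<in> A j) \<omega>
                  = (\<Prod>j\<in>J. cond_prob_sigma M F (\<lambda>\<omega>'. Y j \<omega>' \<in> A j) \<omega>)))"

definition beta_prime_density :: "real \<Rightarrow> real \<Rightarrow> real \<Rightarrow> real" where
  "beta_prime_density m l x =
     (if x > 0 then x powr (m - 1) * (1 + x) powr (- m - l - 1) / Beta m (l + 1) else 0)"

definition geometric_mass :: "real \<Rightarrow> nat \<Rightarrow> real" where
  "geometric_mass a k = a ^ k / (1 + a) ^ (k + 1)"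

(* The variable "alpha diamond X" realised by the counting sequence G. The coefficient alpha enters
   through the law of G only: given alpha, the G j are i.i.d. with mass function
   geometric_mass alpha. *)
definition nb_op :: "(nat \<Rightarrow> 'a \<Rightarrow> nat) \<Rightarrow> ('a \<Rightarrow> nat) \<Rightarrow> 'a \<Rightarrow> nat" where
  "nb_op G X \<omega> = (\<Sum>j = 1..X \<omega> + 1. G j \<omega>)"

definition pair_proc :: "(nat \<Rightarrow> nat \<Rightarrow> 'a \<Rightarrow> nat) \<Rightarrow> nat \<Rightarrow> 'a \<Rightarrow> nat \<times> nat" where
  "pair_proc Y t \<omega> = (Y 1 t \<omega>, Y 2 t \<omega>)"

definition past :: "(nat \<Rightarrow> 'a \<Rightarrow> 'b) \<Rightarrow> nat \<Rightarrow> 'a \<Rightarrow> nat \<Rightarrow> 'b" where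
  "past Y t \<omega> = (\<lambda>s\<in>{..<t}. Y s \<omega>)"

(* The sigma-algebra generated by all coefficients alpha i t with i = 1, 2 and t >= 1. *)
definition coeff_sigma :: "'a measure \<Rightarrow> (nat \<Rightarrow> nat \<Rightarrow> 'a \<Rightarrow> real) \<Rightarrow> 'a measure" where
  "coeff_sigma M \<alpha> =
     vimage_algebra (space M) (\<lambda>\<omega>. \<lambda>(i, t)\<in>{1, 2} \<times> {1..}. \<alpha> i t \<omega>)
       (Pi\<^sub>M ({1, 2} \<times> {1..}) (\<lambda>_. borel))"

(* A Markov process with countable state space, in terms of elementary conditional probabilities;
   these are only meaningful when the conditioning event has positive probability. *)
definition markov_process :: "'a measure \<Rightarrow> (nat \<Rightarrow> 'a \<Rightarrow> 'b::countable) \<Rightarrow> bool" where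
  "markov_process M Y \<longleftrightarrow>
     (\<forall>t. Y t \<in> measurable M (count_space UNIV)) \<and>
     (\<forall>t\<ge>1. \<forall>x y.
        \<P>(\<omega> in M. \<forall>s<t. Y s \<omega> = x s) > 0 \<longrightarrow>
        \<P>(\<omega> in M. Y t \<omega> = y \<bar> \<forall>s<t. Y s \<omega> = x s) = \<P>(\<omega> in M. Y t \<omega> = y \<bar> Y (t - 1) \<omega> = x (t - 1)))"

(* Component indices are i = 1, 2; X is indexed by t >= 0 with an arbitrary initial vector,
   while alpha, G, Z matter only for t >= 1, and G i t j only for j >= 1. *)
locale brcmnbinar1 = prob_space M
  for M :: "'a measure" +
  fixes m :: "nat \<Rightarrow> real" and l :: real
    and \<mu> \<sigma>Z :: "nat \<Rightarrow> real" and \<phi> :: real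
    and fZ :: "(nat \<times> nat) pmf"
    and \<alpha> :: "nat \<Rightarrow> nat \<Rightarrow> 'a \<Rightarrow> real"
    and G :: "nat \<Rightarrow> nat \<Rightarrow> nat \<Rightarrow> 'a \<Rightarrow> nat"
    and Z X :: "nat \<Rightarrow> nat \<Rightarrow> 'a \<Rightarrow> nat"
  assumes l_gt_1: "l > 1"
    and m_range: "\<And>i. i \<in> {1, 2} \<Longrightarrow> 0 < m i \<and> m i < l"
    and X_measurable: "\<And>i t. i \<in> {1, 2} \<Longrightarrow> random_variable (count_space UNIV) (X i t)"
    and X_rec: "\<And>i t \<omega>. i \<in> {1, 2} \<Longrightarrow> t \<ge> 1 \<Longrightarrow> \<omega> \<in> space M \<Longrightarrow>
                  X i t \<omega> = nb_op (G i t) (X i (t - 1)) \<omega> + Z i t \<omega>"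
    and coeff_indep: "\<And>i. i \<in> {1, 2} \<Longrightarrow> indep_vars (\<lambda>_. borel) (\<alpha> i) {1..}"
    and coeff_distr: "\<And>i t. i \<in> {1, 2} \<Longrightarrow> t \<ge> 1 \<Longrightarrow>
                        distributed M lborel (\<alpha> i t) (\<lambda>x. ennreal (beta_prime_density (m i) l x))"
    and coeff_mutual: "indep_var
                         (Pi\<^sub>M {1..} (\<lambda>_. borel)) (\<lambda>\<omega>. \<lambda>t\<in>{1..}. \<alpha> 1 t \<omega>)
                         (Pi\<^sub>M {1..} (\<lambda>_. borel)) (\<lambda>\<omega>. \<lambda>t\<in>{1..}. \<alpha> 2 t \<omega>)"
    and innov_indep: "indep_vars (\<lambda>_. count_space UNIV) (pair_proc Z) {1..}"
    and innov_distr: "\<And>t. t \<ge> 1 \<Longrightarrow>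
                        distr M (count_space UNIV) (pair_proc Z t) = measure_pmf fZ"
    and innov_sq_integrable: "\<And>i t. i \<in> {1, 2} \<Longrightarrow> t \<ge> 1 \<Longrightarrow>
                        integrable M (\<lambda>\<omega>. (real (Z i t \<omega>))\<^sup>2)"
    and innov_mean: "\<And>i t. i \<in> {1, 2} \<Longrightarrow> t \<ge> 1 \<Longrightarrow> expectation (\<lambda>\<omega>. real (Z i t \<omega>)) = \<mu> i"
    and innov_var: "\<And>i t. i \<in> {1, 2} \<Longrightarrow> t \<ge> 1 \<Longrightarrow> variance (\<lambda>\<omega>. real (Z i t \<omega>)) = (\<sigma>Z i)\<^sup>2"
    and innov_cov: "\<And>t. t \<ge> 1 \<Longrightarrow>
                      expectation (\<lambda>\<omega>. (real (Z 1 t \<omega>) - \<mu> 1) * (real (Z 2 t \<omega>) - \<mu> 2)) = \<phi>"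
    and innov_indep_past: "\<And>t. t \<ge> 1 \<Longrightarrow>
          indep_rv M
            (count_space UNIV) (pair_proc Z t)
            (count_space UNIV \<Otimes>\<^sub>M Pi\<^sub>M {..<t} (\<lambda>_. count_space UNIV))
            (\<lambda>\<omega>. ((nb_op (G 1 t) (X 1 (t - 1)) \<omega>, nb_op (G 2 t) (X 2 (t - 1)) \<omega>),
                  past (pair_proc X) t \<omega>))"
    and count_cond_indep: "cond_indep_vars M (coeff_sigma M \<alpha>) (\<lambda>_. count_space UNIV)
                             (\<lambda>(i, t, j). G i t j) ({1, 2} \<times> {1..} \<times> {1..})"
    and count_cond_distr: "\<And>i t j k. i \<in> {1, 2} \<Longrightarrow> t \<ge> 1 \<Longrightarrow> j \<ge> 1 \<Longrightarrow>
          AE \<omega> in M. cond_prob_sigma M (coeff_sigma M \<alpha>) (\<lambda>\<omega>'. G i t j \<omega>' = k) \<omega>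
                     = geometric_mass (\<alpha> i t \<omega>) k"
    and triples_indep: "indep_vars
          (\<lambda>_. (borel \<Otimes>\<^sub>M borel) \<Otimes>\<^sub>M Pi\<^sub>M ({1, 2} \<times> {1..}) (\<lambda>_. count_space UNIV) \<Otimes>\<^sub>M count_space UNIV)
          (\<lambda>t \<omega>. ((\<alpha> 1 t \<omega>, \<alpha> 2 t \<omega>), (\<lambda>(i, j)\<in>{1, 2} \<times> {1..}. G i t j \<omega>), pair_proc Z t \<omega>))
          {1..}"
    and triple_indep_past: "\<And>t. t \<ge> 1 \<Longrightarrow>
          indep_rv M
            ((borel \<Otimes>\<^sub>M borel) \<Otimes>\<^sub>M Pi\<^sub>M ({1, 2} \<times> {1..}) (\<lambda>_. count_space UNIV) \<Otimes>\<^sub>M count_space UNIV)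
            (\<lambda>\<omega>. ((\<alpha> 1 t \<omega>, \<alpha> 2 t \<omega>), (\<lambda>(i, j)\<in>{1, 2} \<times> {1..}. G i t j \<omega>), pair_proc Z t \<omega>))
            (Pi\<^sub>M {..<t} (\<lambda>_. count_space UNIV)) (past (pair_proc X) t)"
    and distinct_params: "(m 1, \<mu> 1) \<noteq> (m 2, \<mu> 2)"

end

theory Submission
  imports Defs
begin

text \<open>
  Given the coefficient \<open>a\<close>, a configuration of \<open>p\<close> counting variables with total \<open>k\<close> has
  probability \<open>a^k / (1 + a)^(k + p)\<close>, whatever the individual values are. Integrating this against
  the beta prime law gives a quotient of Beta functions, and the number of configurations with total
  \<open>k\<close> supplies the binomial coefficient. On an event of the past that fixes the last state, the
  counting variables are independent of the past and the innovation is independent of both, so the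
  conditional law of the next state depends on that last state only. Taking the event to be the
  whole past path, or only the last state, gives the same value, which is the Markov property.
\<close>

section \<open>Beta prime integrals and geometric weights\<close>

lemma beta_prime_integral:
  fixes a b :: real
  assumes a: "a > 0" and b: "b > 0"
  shows "(\<integral>x. indicator {0<..} x * (x powr (a - 1) * (1 + x) powr (- a - b)) \<partial>lborel) = Beta a b"
proof -
  \<comment> \<open>substitute \<open>x = t / (1 - t)\<close> in the Beta integral over the unit interval\<close>
  define f where "f = (\<lambda>x::real. x powr (a - 1) * (1 + x) powr (- a - b))"
  define g where "g = (\<lambda>t::real. t / (1 - t))"
  define g' where "g' = (\<lambda>t::real. 1 / (1 - t)\<^sup>2)"
  have image: "g ` {0<..<1} = {0<..}"
  proof (intro equalityI subsetI)
    fix x :: real assume "x \<in> {0<..}"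
    then show "x \<in> g ` {0<..<1}"
      by (intro image_eqI[of _ _ "x / (1 + x)"]) (auto simp: g_def field_simps)
  qed (auto simp: g_def)
  have inj: "inj_on g {0<..<1}"
    by (auto simp: inj_on_def g_def field_simps)
  have deriv: "(g has_field_derivative g' t) (at t within {0<..<1})" if "t \<in> {0<..<1}" for t
    using that unfolding g_def g'_def
    by (auto intro!: derivative_eq_intros simp: power2_eq_square)
  have subst: "\<bar>g' t\<bar> * f (g t) = t powr (a - 1) * (1 - t) powr (b - 1)" if "t \<in> {0<..<1}" for t
  proof -
    have t: "0 < t" "0 < 1 - t" using that by auto
    have "1 + g t = 1 / (1 - t)" using t by (simp add: g_def field_simps)
    moreover have "g' t = (1 - t) powr (- 2)"
      using t by (simp add: g'_def powr_minus powr_numeral inverse_eq_divide)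
    ultimately have "\<bar>g' t\<bar> * f (g t) =
        (1 - t) powr (- 2) * ((t powr (a - 1) / (1 - t) powr (a - 1)) * (1 / (1 - t) powr (- a - b)))"
      using t by (simp add: f_def g_def powr_divide)
    also have "\<dots> = t powr (a - 1) * ((1 - t) powr (- 2) * (1 - t) powr (- (a - 1)) * (1 - t) powr (- (- a - b)))"
      by (simp only: divide_inverse powr_minus mult_ac mult_1_left)
    \<comment> \<open>The exponents of \<open>1 - t\<close> add up to
      \<open>-2 - (a - 1) + (a + b) = b - 1\<close>.\<close>
    also have "\<dots> = t powr (a - 1) * (1 - t) powr (b - 1)"
      by (simp add: powr_add[symmetric])
    finally show ?thesis .
  qed
  have beta: "((\<lambda>t. t powr (a - 1) * (1 - t) powr (b - 1)) has_integral Beta a b) {0<..<1}"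
    using has_integral_Beta_real[OF a b] by (simp add: has_integral_Icc_iff_Ioo)
  then have "((\<lambda>t. \<bar>g' t\<bar> * f (g t)) has_integral Beta a b) {0<..<1}"
    by (rule has_integral_eq[rotated]) (simp add: subst)
  \<comment> \<open>Change of variables needs absolute integrability, which follows from
    integrability because the integrand is nonnegative.\<close>
  moreover from this have "(\<lambda>t. \<bar>g' t\<bar> * f (g t)) absolutely_integrable_on {0<..<1}"
    by (intro nonnegative_absolutely_integrable_1) (auto simp: f_def intro: has_integral_integrable)
  ultimately have "f absolutely_integrable_on {0<..} \<and> integral {0<..} f = Beta a b"
    using has_absolute_integral_change_of_variables_1'[OF _ deriv inj, of f "Beta a b"]
    by (simp add: image integral_unique)
  then have "(LINT x:{0<..}|lebesgue. f x) = Beta a b"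
    using set_lebesgue_integral_eq_integral(2)[of "{0<..}" f] by simp
  \<comment> \<open>So far the integral is taken over the completed measure; for a Borel integrand
    it agrees with the one over \<open>lborel\<close>.\<close>
  then show ?thesis
    unfolding set_lebesgue_integral_def f_def by (subst (asm) integral_completion) auto
qed

text \<open>The cut-off at \<open>0\<close> keeps the weight bounded on the whole real line; the coefficients are almost surely positive.\<close>
definition nb_weight :: "nat \<Rightarrow> nat \<Rightarrow> real \<Rightarrow> real" where
  "nb_weight p k a = (if a > 0 then a ^ k / (1 + a) ^ (k + p) else 0)"

lemma nb_weight_measurable [measurable]: "nb_weight p k \<in> borel_measurable borel"
  unfolding nb_weight_def by measurable

text \<open>For \<open>a > 0\<close> both \<open>a\<close> and \<open>1\<close> are at most
  \<open>1 + a\<close>, so the denominator dominates. The bounds make the weight of a random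
  coefficient integrable.\<close>

lemma nb_weight_bounds: "0 \<le> nb_weight p k a" "nb_weight p k a \<le> 1"
proof -
  have "a ^ k \<le> (1 + a) ^ (k + p)" if "a > 0"
  proof -
    have "a ^ k * 1 \<le> (1 + a) ^ k * (1 + a) ^ p"
      using that by (intro mult_mono power_mono one_le_power) auto
    then show ?thesis by (simp add: power_add)
  qed
  then show "0 \<le> nb_weight p k a" "nb_weight p k a \<le> 1"
    by (auto simp: nb_weight_def)
qed

text \<open>Exponents add up to the total in the numerator and to the total plus the length in the
  denominator. The shift \<open>j - 1\<close> reconciles counting variables numbered from 1 with
  list positions numbered from 0.\<close>

lemma prod_geometric_mass:
  assumes "a > 0"
  shows "(\<Prod>j = 1..length ns. geometric_mass a (ns ! (j - 1))) = nb_weight (length ns) (sum_list ns) a"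
proof -
  have "(\<Prod>j = 1..length ns. geometric_mass a (ns ! (j - 1))) = (\<Prod>n\<leftarrow>ns. geometric_mass a n)"
    by (simp add: prod.list_conv_set_nth prod.atLeast1_atMost_eq atLeast0LessThan)
  also have "\<dots> = nb_weight (length ns) (sum_list ns) a"
    using assms by (induction ns) (auto simp: nb_weight_def geometric_mass_def power_add)
  finally show ?thesis .
qed

text \<open>The weight turns the density into an unnormalised beta prime density with
  \<open>m\<close> raised by \<open>k\<close> and \<open>l + 1\<close> raised by
  \<open>p\<close>.\<close>

lemma integral_beta_prime_density_nb_weight:
  assumes "0 < m" "0 < l"
  shows "(\<integral>x. beta_prime_density m l x * nb_weight p k x \<partial>lborel)
    = Beta (real k + m) (real p + l + 1) / Beta m (l + 1)"
proof -
  have "beta_prime_density m l x * nb_weight p k x =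
      (indicator {0<..} x * (x powr ((real k + m) - 1) * (1 + x) powr (- (real k + m) - (real p + l + 1)))) / Beta m (l + 1)"
    for x
  proof (cases "x > 0")
    case True
    have "x powr (real k + m - 1) = x powr (m - 1) * x ^ k"
      using True by (simp add: powr_realpow[symmetric] powr_add[symmetric] algebra_simps)
    moreover have "(1 + x) powr (- (real k + m) - (real p + l + 1)) = (1 + x) powr (- m - l - 1) / (1 + x) ^ (k + p)"
      using True by (simp add: powr_realpow[symmetric] powr_diff[symmetric] algebra_simps)
    ultimately show ?thesis
      using True by (simp add: beta_prime_density_def nb_weight_def mult_ac)
  qed (simp add: beta_prime_density_def nb_weight_def)
  then show ?thesis
    using beta_prime_integral[of "real k + m" "real p + l + 1"] assms by simp
qed

section \<open>The mixed negative binomial mass function\<close>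

text \<open>No entry exceeds the total. Finiteness lets probabilities be summed over
  configurations.\<close>

lemma finite_lists_sum: "finite {ns :: nat list. length ns = p \<and> sum_list ns = k}"
proof (rule finite_subset)
  show "{ns. length ns = p \<and> sum_list ns = k} \<subseteq> {ns. set ns \<subseteq> {..k} \<and> length ns = p}"
    using member_le_sum_list by auto
qed (simp add: finite_lists_length_eq)

text \<open>The mass at \<open>k\<close> of the operator applied to the state \<open>x\<close>, with
  the beta prime coefficient averaged out; the Gamma form is the one in the transition
  formula.\<close>

definition nb_mix :: "real \<Rightarrow> real \<Rightarrow> nat \<Rightarrow> nat \<Rightarrow> real" where
  "nb_mix m l x k = real ((x + k) choose k) *
     (Gamma (real x + l + 2) * Gamma (real k + m) * Gamma (l + m + 1)
      / (Gamma (real x + real k + m + l + 2) * Gamma (l + 1) * Gamma m))"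

text \<open>In state \<open>x\<close> the operator has \<open>Suc x\<close> summands, so the Beta
  quotient is the expected weight of one configuration and the binomial coefficient counts
  configurations.\<close>

lemma nb_mix_Beta:
  "nb_mix m l x k = real ((x + k) choose k) * (Beta (real k + m) (real (Suc x) + l + 1) / Beta m (l + 1))"
  by (simp add: nb_mix_def Beta_def algebra_simps)

section \<open>Product rules for independence\<close>

lemma (in prob_space) indep_rvD:
  assumes "indep_rv M N X K Y" "A \<in> sets N" "B \<in> sets K"
  shows "prob {\<omega> \<in> space M. X \<omega> \<in> A \<and> Y \<omega> \<in> B} =
    prob {\<omega> \<in> space M. X \<omega> \<in> A} * prob {\<omega> \<in> space M. Y \<omega> \<in> B}"
proof -
  have "prob ((X -` A \<inter> space M) \<inter> (Y -` B \<inter> space M)) = prob (X -` A \<inter> space M) * prob (Y -` B \<inter> space M)"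
    using assms unfolding indep_rv_def by (intro indep_setD) auto
  moreover have "(X -` A \<inter> space M) \<inter> (Y -` B \<inter> space M) = {\<omega> \<in> space M. X \<omega> \<in> A \<and> Y \<omega> \<in> B}"
    "X -` A \<inter> space M = {\<omega> \<in> space M. X \<omega> \<in> A}" "Y -` B \<inter> space M = {\<omega> \<in> space M. Y \<omega> \<in> B}"
    by auto
  ultimately show ?thesis by simp
qed

lemma cond_indep_varsD:
  assumes "cond_indep_vars M F N Y I" "J \<subseteq> I" "finite J" "\<And>j. j \<in> J \<Longrightarrow> A j \<in> sets (N j)"
  shows "AE \<omega> in M. cond_prob_sigma M F (\<lambda>\<omega>'. \<forall>j\<in>J. Y j \<omega>' \<in> A j) \<omega>
    = (\<Prod>j\<in>J. cond_prob_sigma M F (\<lambda>\<omega>'. Y j \<omega>' \<in> A j) \<omega>)"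
  using assms unfolding cond_indep_vars_def by blast

context brcmnbinar1
begin

section \<open>The random coefficients\<close>

lemma coeff_measurable:
  assumes "i \<in> {1, 2}" "t \<ge> 1"
  shows "\<alpha> i t \<in> borel_measurable M"
  using distributed_measurable[OF coeff_distr[OF assms]] by simp

lemma nb_weight_coeff_measurable:
  assumes "i \<in> {1, 2}" "t \<ge> 1"
  shows "(\<lambda>\<omega>. nb_weight p k (\<alpha> i t \<omega>)) \<in> borel_measurable M"
  using coeff_measurable[OF assms] by measurable

lemma count_measurable:
  assumes "i \<in> {1, 2}" "t \<ge> 1" "j \<ge> 1"
  shows "G i t j \<in> measurable M (count_space UNIV)"
  using count_cond_indep assms unfolding cond_indep_vars_def by fastforce

text \<open>The density vanishes off the positive half-line, so the cut-off in
  \<open>nb_weight\<close> is almost surely invisible.\<close>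

lemma coeff_pos:
  assumes "i \<in> {1, 2}" "t \<ge> 1"
  shows "AE \<omega> in M. 0 < \<alpha> i t \<omega>"
  by (subst distributed_AE2[OF coeff_distr[OF assms]])
     (auto intro!: AE_I2 simp: beta_prime_density_def split: if_splits)

lemma coeff_subalgebra: "finite_measure_subalgebra M (coeff_sigma M \<alpha>)"
proof
  have "(\<lambda>\<omega>. \<lambda>(i, t)\<in>{1, 2} \<times> {1..}. \<alpha> i t \<omega>) \<in> measurable M (Pi\<^sub>M ({1, 2} \<times> {1..}) (\<lambda>_. borel))"
    by (intro measurable_restrict) (auto intro!: coeff_measurable)
  then have "sets (coeff_sigma M \<alpha>) \<subseteq> events"
    unfolding coeff_sigma_def by (intro sets_image_in_sets) auto
  then show "subalgebra M (coeff_sigma M \<alpha>)"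
    by (simp add: subalgebra_def coeff_sigma_def)
qed

text \<open>The tower property: it converts what is assumed given the coefficients into
  unconditional probabilities.\<close>

lemma expectation_cond_prob:
  assumes "{\<omega> \<in> space M. P \<omega>} \<in> events"
  shows "expectation (cond_prob_sigma M (coeff_sigma M \<alpha>) P) = prob {\<omega> \<in> space M. P \<omega>}"
proof -
  interpret finite_measure_subalgebra M "coeff_sigma M \<alpha>"
    by (rule coeff_subalgebra)
  show ?thesis
    unfolding cond_prob_sigma_def using assms
    by (subst real_cond_exp_int(2)) (auto intro!: integrable_real_indicator simp: emeasure_eq_measure)
qed

lemma expectation_nb_weight:
  assumes "i \<in> {1, 2}" "t \<ge> 1"
  shows "expectation (\<lambda>\<omega>. nb_weight p k (\<alpha> i t \<omega>)) = Beta (real k + m i) (real p + l + 1) / Beta (m i) (l + 1)"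
proof -
  have "0 \<le> beta_prime_density (m i) l x" for x
    using m_range[OF assms(1)] l_gt_1 by (auto simp: beta_prime_density_def Beta_def intro!: divide_nonneg_nonneg mult_nonneg_nonneg Gamma_real_nonneg)
  then show ?thesis
    using distributed_integral[OF coeff_distr[OF assms], of "nb_weight p k"] m_range[OF assms(1)] l_gt_1
    by (simp add: integral_beta_prime_density_nb_weight)
qed

text \<open>Evaluation at time \<open>t\<close> is measurable, so independence of the two
  coefficient sequences passes to their entries.\<close>

lemma coeff_pair_indep:
  assumes "t \<ge> 1"
  shows "indep_var borel (\<alpha> 1 t) borel (\<alpha> 2 t)"
proof -
  have "indep_var borel ((\<lambda>f. f t) \<circ> (\<lambda>\<omega>. \<lambda>t\<in>{1..}. \<alpha> 1 t \<omega>)) borel ((\<lambda>f. f t) \<circ> (\<lambda>\<omega>. \<lambda>t\<in>{1..}. \<alpha> 2 t \<omega>))"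
    using assms by (intro indep_var_compose[OF coeff_mutual] measurable_component_singleton) auto
  then show ?thesis
    using assms by (simp add: comp_def)
qed

lemma expectation_nb_weight_prod:
  assumes "t \<ge> 1"
  shows "expectation (\<lambda>\<omega>. nb_weight p k (\<alpha> 1 t \<omega>) * nb_weight q s (\<alpha> 2 t \<omega>)) =
    expectation (\<lambda>\<omega>. nb_weight p k (\<alpha> 1 t \<omega>)) * expectation (\<lambda>\<omega>. nb_weight q s (\<alpha> 2 t \<omega>))"
proof (rule indep_var_lebesgue_integral)
  show "indep_var borel (\<lambda>\<omega>. nb_weight p k (\<alpha> 1 t \<omega>)) borel (\<lambda>\<omega>. nb_weight q s (\<alpha> 2 t \<omega>))"
    using indep_var_compose[OF coeff_pair_indep[OF assms] nb_weight_measurable nb_weight_measurable]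
    by (simp add: comp_def)
  show "integrable M (\<lambda>\<omega>. nb_weight p k (\<alpha> 1 t \<omega>))" "integrable M (\<lambda>\<omega>. nb_weight q s (\<alpha> 2 t \<omega>))"
    using assms nb_weight_bounds
    by (auto intro!: integrable_const_bound[where B = 1] nb_weight_coeff_measurable)
qed

section \<open>The joint law of the counting variables\<close>

text \<open>A list encodes a configuration so that configurations with a given length and total can
  be counted by a known cardinality formula.\<close>

definition counts :: "nat \<Rightarrow> nat \<Rightarrow> nat \<Rightarrow> 'a \<Rightarrow> nat list" where
  "counts i t p \<omega> = map (\<lambda>j. G i t j \<omega>) [1..<Suc p]"

lemma counts_eq_iff:
  "counts i t p \<omega> = ns \<longleftrightarrow> length ns = p \<and> (\<forall>j\<in>{1..p}. G i t j \<omega> = ns ! (j - 1))"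
proof -
  have "(\<forall>j<p. G i t (Suc j) \<omega> = ns ! j) \<longleftrightarrow> (\<forall>j\<in>{1..p}. G i t j \<omega> = ns ! (j - 1))"
    by (auto simp: Suc_le_eq dest!: Suc_le_D) (metis One_nat_def Suc_le_eq diff_Suc_1 gr0_conv_Suc)
  then show ?thesis
    by (auto simp: counts_def list_eq_iff_nth_eq simp del: upt_Suc)
qed

lemma sum_list_counts: "sum_list (counts i t p \<omega>) = (\<Sum>j = 1..p. G i t j \<omega>)"
  by (simp add: counts_def interv_sum_list_conv_sum_set_nat atLeastLessThanSuc_atLeastAtMost del: upt_Suc)

lemma counts_measurable:
  assumes "i \<in> {1, 2}" "t \<ge> 1"
  shows "{\<omega> \<in> space M. counts i t p \<omega> = ns} \<in> events"
proof -
  have "{\<omega> \<in> space M. G i t j \<omega> = n} \<in> events" if "j \<in> {1..p}" for j n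
    using that assms by (intro measurable_sets_Collect[OF count_measurable, of _ _ _ "\<lambda>k. k = n"]) auto
  then show ?thesis
    unfolding counts_eq_iff by (intro sets.sets_Collect_conj sets.sets_Collect_const sets.sets_Collect_finite_All) auto
qed

text \<open>Given the coefficients, the probability is a product of geometric masses, hence of two
  weights, one per coefficient. Its expectation factors because the two coefficients are
  independent.\<close>

lemma prob_counts:
  assumes t: "t \<ge> 1"
  shows "prob {\<omega> \<in> space M. counts 1 t (length ns) \<omega> = ns \<and> counts 2 t (length ms) \<omega> = ms} =
    (Beta (real (sum_list ns) + m 1) (real (length ns) + l + 1) / Beta (m 1) (l + 1)) *
    (Beta (real (sum_list ms) + m 2) (real (length ms) + l + 1) / Beta (m 2) (l + 1))"
proof -
  let ?F = "coeff_sigma M \<alpha>"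
  \<comment> \<open>Both components are gathered in one index set, so that conditional independence
    is used once, across components as well as within them.\<close>
  define J where "J = (\<lambda>j. (1::nat, t, j)) ` {1..length ns} \<union> (\<lambda>j. (2, t, j)) ` {1..length ms}"
  define v where "v = (\<lambda>(i::nat, t::nat, j::nat). if i = 1 then ns ! (j - 1) else ms ! (j - 1))"
  define Y where "Y = (\<lambda>(i, t, j). G i t j)"
  have J: "finite J" "J \<subseteq> {1, 2} \<times> {1..} \<times> {1..}"
    using t by (auto simp: J_def)
  have event: "counts 1 t (length ns) \<omega> = ns \<and> counts 2 t (length ms) \<omega> = ms \<longleftrightarrow> (\<forall>j\<in>J. Y j \<omega> \<in> {v j})" for \<omega>
    by (simp add: counts_eq_iff J_def v_def Y_def ball_Un)
  have "AE \<omega> in M. cond_prob_sigma M ?F (\<lambda>\<omega>'. \<forall>j\<in>J. Y j \<omega>' \<in> {v j}) \<omega>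
      = (\<Prod>j\<in>J. cond_prob_sigma M ?F (\<lambda>\<omega>'. Y j \<omega>' \<in> {v j}) \<omega>)"
    by (rule cond_indep_varsD[OF count_cond_indep[folded Y_def] J(2,1), where A = "\<lambda>z. {v z}"]) simp
  moreover have "AE \<omega> in M. \<forall>j\<in>J. cond_prob_sigma M ?F (\<lambda>\<omega>'. Y j \<omega>' \<in> {v j}) \<omega>
      = geometric_mass (\<alpha> (fst j) t \<omega>) (v j)"
  proof (intro AE_finite_allI J(1))
    fix z assume "z \<in> J"
    then obtain i j where z: "z = (i, t, j)" "i \<in> {1, 2}" "j \<ge> 1"
      unfolding J_def by auto
    show "AE \<omega> in M. cond_prob_sigma M ?F (\<lambda>\<omega>'. Y z \<omega>' \<in> {v z}) \<omega> = geometric_mass (\<alpha> (fst z) t \<omega>) (v z)"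
      using count_cond_distr[OF z(2) t z(3), of "v z"] by (simp add: z(1) Y_def)
  qed
  moreover have "AE \<omega> in M. 0 < \<alpha> 1 t \<omega>" "AE \<omega> in M. 0 < \<alpha> 2 t \<omega>"
    using t by (simp_all add: coeff_pos)
  ultimately have "AE \<omega> in M. cond_prob_sigma M ?F (\<lambda>\<omega>'. \<forall>j\<in>J. Y j \<omega>' \<in> {v j}) \<omega>
      = nb_weight (length ns) (sum_list ns) (\<alpha> 1 t \<omega>) * nb_weight (length ms) (sum_list ms) (\<alpha> 2 t \<omega>)"
  proof eventually_elim
    case (elim \<omega>)
    have "(\<Prod>j\<in>J. geometric_mass (\<alpha> (fst j) t \<omega>) (v j)) =
        (\<Prod>j = 1..length ns. geometric_mass (\<alpha> 1 t \<omega>) (ns ! (j - 1))) *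
        (\<Prod>j = 1..length ms. geometric_mass (\<alpha> 2 t \<omega>) (ms ! (j - 1)))"
      \<comment> \<open>The two halves of \<open>J\<close> are disjoint because their first
        coordinates are 1 and 2.\<close>
      unfolding J_def by (subst prod.union_disjoint) (auto simp: prod.reindex inj_on_def v_def)
    with elim show ?case
      by (simp add: prod_geometric_mass[symmetric])
  qed
  then have "expectation (cond_prob_sigma M ?F (\<lambda>\<omega>'. \<forall>j\<in>J. Y j \<omega>' \<in> {v j})) =
      expectation (\<lambda>\<omega>. nb_weight (length ns) (sum_list ns) (\<alpha> 1 t \<omega>) * nb_weight (length ms) (sum_list ms) (\<alpha> 2 t \<omega>))"
    using t by (intro integral_cong_AE borel_measurable_times nb_weight_coeff_measurable)
      (simp_all add: cond_prob_sigma_def)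
  moreover have "{\<omega> \<in> space M. counts 1 t (length ns) \<omega> = ns \<and> counts 2 t (length ms) \<omega> = ms} \<in> events"
    using t by (intro sets.sets_Collect_conj counts_measurable) auto
  ultimately show ?thesis
    using t expectation_cond_prob[of "\<lambda>\<omega>. \<forall>j\<in>J. Y j \<omega> \<in> {v j}"]
      expectation_nb_weight_prod[OF t] expectation_nb_weight[of 1 t] expectation_nb_weight[of 2 t]
    unfolding event by simp
qed

text \<open>The event is a finite disjoint union over pairs of configurations, all of which have the
  same probability.\<close>

lemma prob_sums:
  assumes t: "t \<ge> 1"
  shows "prob {\<omega> \<in> space M. (\<Sum>j = 1..x1 + 1. G 1 t j \<omega>) = k \<and> (\<Sum>j = 1..x2 + 1. G 2 t j \<omega>) = s} =
    nb_mix (m 1) l x1 k * nb_mix (m 2) l x2 s"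
proof -
  define L where "L = (\<lambda>x k. {ns :: nat list. length ns = Suc x \<and> sum_list ns = k})"
  define E where "E = (\<lambda>(ns, ms). {\<omega> \<in> space M. counts 1 t (Suc x1) \<omega> = ns \<and> counts 2 t (Suc x2) \<omega> = ms})"
  have len: "length (counts i t p \<omega>) = p" for i p \<omega>
    by (simp add: counts_def)
  have "{\<omega> \<in> space M. (\<Sum>j = 1..x1 + 1. G 1 t j \<omega>) = k \<and> (\<Sum>j = 1..x2 + 1. G 2 t j \<omega>) = s} =
      (\<Union>z\<in>L x1 k \<times> L x2 s. E z)"
    by (auto simp: E_def L_def len sum_list_counts simp del: sum.cl_ivl_Suc)
  also have "prob \<dots> = (\<Sum>z\<in>L x1 k \<times> L x2 s. prob (E z))"
  proof (rule finite_measure_finite_Union)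
    show "finite (L x1 k \<times> L x2 s)"
      by (auto simp: L_def finite_lists_sum)
    show "E ` (L x1 k \<times> L x2 s) \<subseteq> events"
      using t by (auto simp: E_def intro!: sets.sets_Collect_conj counts_measurable)
    show "disjoint_family_on E (L x1 k \<times> L x2 s)"
      by (auto simp: disjoint_family_on_def E_def)
  qed
  also have "\<dots> = (\<Sum>z\<in>L x1 k \<times> L x2 s.
      (Beta (real k + m 1) (real (Suc x1) + l + 1) / Beta (m 1) (l + 1)) *
      (Beta (real s + m 2) (real (Suc x2) + l + 1) / Beta (m 2) (l + 1)))"
  proof (rule sum.cong[OF refl], clarify)
    fix ns ms assume "ns \<in> L x1 k" "ms \<in> L x2 s"
    then show "prob (E (ns, ms)) =
        (Beta (real k + m 1) (real (Suc x1) + l + 1) / Beta (m 1) (l + 1)) *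
        (Beta (real s + m 2) (real (Suc x2) + l + 1) / Beta (m 2) (l + 1))"
      using prob_counts[OF t, of ns ms] by (simp add: E_def L_def)
  qed
  also have "\<dots> = nb_mix (m 1) l x1 k * nb_mix (m 2) l x2 s"
  proof -
    \<comment> \<open>Stars and bars with \<open>x + 1\<close> boxes and \<open>k\<close>
      balls.\<close>
    have "card (L x k) = (x + k) choose k" for x k
      using card_length_sum_list[of "Suc x" k] by (simp add: L_def add.commute)
    then show ?thesis
      by (simp add: card_cartesian_product nb_mix_Beta)
  qed
  finally show ?thesis .
qed

section \<open>The one-step law on an event of the past\<close>

text \<open>A general \<open>A\<close> that fixes the last state covers both the whole path and the
  last state alone. The product form holds for null events too; division comes later.\<close>

lemma transition_on_past:
  assumes t: "t \<ge> 1"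
    and A: "A \<in> sets (Pi\<^sub>M {..<t} (\<lambda>_. count_space UNIV))"
    and last: "\<And>f. f \<in> A \<Longrightarrow> f (t - 1) = (x1, x2)"
  shows "prob {\<omega> \<in> space M. past (pair_proc X) t \<omega> \<in> A \<and> pair_proc X t \<omega> = (y1, y2)} =
    prob {\<omega> \<in> space M. past (pair_proc X) t \<omega> \<in> A} *
    (\<Sum>k = 0..y1. \<Sum>s = 0..y2. pmf fZ (y1 - k, y2 - s) * nb_mix (m 1) l x1 k * nb_mix (m 2) l x2 s)"
proof -
  let ?P = "past (pair_proc X) t"
  \<comment> \<open>The operator values and the past form one variable, because the innovation is
    independent of them jointly.\<close>
  define V where "V = (\<lambda>\<omega>. ((nb_op (G 1 t) (X 1 (t - 1)) \<omega>, nb_op (G 2 t) (X 2 (t - 1)) \<omega>), ?P \<omega>))"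
  define T where "T = (\<lambda>\<omega>. ((\<alpha> 1 t \<omega>, \<alpha> 2 t \<omega>), (\<lambda>(i, j)\<in>{1, 2} \<times> {1..}. G i t j \<omega>), pair_proc Z t \<omega>))"
  define N where "N = ((borel :: real measure) \<Otimes>\<^sub>M (borel :: real measure)) \<Otimes>\<^sub>M
    Pi\<^sub>M ({1, 2} \<times> {1..}) (\<lambda>_ :: nat \<times> nat. count_space (UNIV :: nat set)) \<Otimes>\<^sub>M count_space (UNIV :: (nat \<times> nat) set)"
  note indep_V = innov_indep_past[OF t, folded V_def]
  note indep_T = triple_indep_past[OF t, folded T_def N_def]
  have V_meas: "V \<in> measurable M (count_space UNIV \<Otimes>\<^sub>M Pi\<^sub>M {..<t} (\<lambda>_. count_space UNIV))"
    and Z_meas: "pair_proc Z t \<in> measurable M (count_space UNIV)"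
    using indep_V by (auto simp: indep_rv_def)
  define E where "E = (\<lambda>(k, s). {\<omega> \<in> space M. pair_proc Z t \<omega> \<in> {(y1 - k, y2 - s)} \<and> V \<omega> \<in> {(k, s)} \<times> A})"
  have X_last: "X 1 (t - 1) \<omega> = x1 \<and> X 2 (t - 1) \<omega> = x2" if "?P \<omega> \<in> A" for \<omega>
    using last[OF that] t by (simp add: past_def pair_proc_def)
  have prob_Z: "prob {\<omega> \<in> space M. pair_proc Z t \<omega> \<in> {z}} = pmf fZ z" for z
  proof -
    have "pmf fZ z = measure (distr M (count_space UNIV) (pair_proc Z t)) {z}"
      by (simp add: innov_distr[OF t] pmf.rep_eq)
    also have "\<dots> = prob {\<omega> \<in> space M. pair_proc Z t \<omega> \<in> {z}}"
      using Z_meas by (subst measure_distr) (auto intro!: arg_cong[where f = prob])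
    finally show ?thesis by simp
  qed
  have prob_V: "prob {\<omega> \<in> space M. V \<omega> \<in> {(k, s)} \<times> A} =
      nb_mix (m 1) l x1 k * nb_mix (m 2) l x2 s * prob {\<omega> \<in> space M. ?P \<omega> \<in> A}" for k s
  proof -
    \<comment> \<open>On \<open>A\<close> the random numbers of summands are frozen at
      \<open>x1 + 1\<close> and \<open>x2 + 1\<close>. The operator event thus becomes an event
      \<open>C\<close> of the time-\<open>t\<close> triple, which is independent of the
      past.\<close>
    define C where "C = {p \<in> space N. (\<Sum>j = 1..x1 + 1. fst (snd p) (1, j)) = k \<and> (\<Sum>j = 1..x2 + 1. fst (snd p) (2, j)) = s}"
    have "(\<lambda>p. fst (snd p) (i, j)) \<in> measurable N (count_space UNIV)"
      if "i \<in> {1, 2}" "j \<in> {1..n}" for i j n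
      unfolding N_def using that
      by (intro measurable_compose[OF measurable_compose[OF measurable_snd measurable_fst]] measurable_component_singleton) auto
    then have sums: "(\<lambda>p. \<Sum>j = 1..n. fst (snd p) (i, j)) \<in> measurable N (count_space UNIV)" if "i \<in> {1, 2}" for i n
      using that by (intro measurable_sum_nat)
    have C: "C \<in> sets N"
      unfolding C_def
      by (intro sets.sets_Collect_conj measurable_sets_Collect[OF sums, where P = "\<lambda>n. n = k"]
          measurable_sets_Collect[OF sums, where P = "\<lambda>n. n = s"]) auto
    have T: "T \<omega> \<in> C \<longleftrightarrow> (\<Sum>j = 1..x1 + 1. G 1 t j \<omega>) = k \<and> (\<Sum>j = 1..x2 + 1. G 2 t j \<omega>) = s" if "\<omega> \<in> space M" for \<omega>
    proof -
      have "T \<omega> \<in> space N"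
        using indep_T that by (auto simp: indep_rv_def dest: measurable_space)
      then show ?thesis by (simp add: C_def T_def del: sum.cl_ivl_Suc)
    qed
    have "prob {\<omega> \<in> space M. V \<omega> \<in> {(k, s)} \<times> A} = prob {\<omega> \<in> space M. T \<omega> \<in> C \<and> ?P \<omega> \<in> A}"
      using X_last by (intro arg_cong[where f = prob]) (auto simp: T V_def nb_op_def simp del: sum.cl_ivl_Suc)
    also have "\<dots> = prob {\<omega> \<in> space M. T \<omega> \<in> C} * prob {\<omega> \<in> space M. ?P \<omega> \<in> A}"
      by (rule indep_rvD[OF indep_T C A])
    also have "{\<omega> \<in> space M. T \<omega> \<in> C} =
        {\<omega> \<in> space M. (\<Sum>j = 1..x1 + 1. G 1 t j \<omega>) = k \<and> (\<Sum>j = 1..x2 + 1. G 2 t j \<omega>) = s}"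
      using T by blast
    finally show ?thesis by (simp only: prob_sums[OF t])
  qed
  have kA: "{(k, s)} \<times> A \<in> sets (count_space UNIV \<Otimes>\<^sub>M Pi\<^sub>M {..<t} (\<lambda>_. count_space UNIV))" for k s :: nat
    using A by (intro pair_measureI) auto
  have E_events: "E (k, s) \<in> events" for k s
  proof -
    have "E (k, s) = (pair_proc Z t -` {(y1 - k, y2 - s)} \<inter> space M) \<inter> (V -` ({(k, s)} \<times> A) \<inter> space M)"
      unfolding E_def by blast
    then show ?thesis
      using measurable_sets[OF Z_meas] measurable_sets[OF V_meas kA] by simp
  qed
  have prob_E: "prob (E (k, s)) = prob {\<omega> \<in> space M. ?P \<omega> \<in> A} *
      (pmf fZ (y1 - k, y2 - s) * nb_mix (m 1) l x1 k * nb_mix (m 2) l x2 s)" for k s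
  proof -
    have "prob (E (k, s)) = prob {\<omega> \<in> space M. pair_proc Z t \<omega> \<in> {(y1 - k, y2 - s)}} *
        prob {\<omega> \<in> space M. V \<omega> \<in> {(k, s)} \<times> A}"
      unfolding E_def prod.case by (rule indep_rvD[OF indep_V _ kA]) simp
    then show ?thesis
      by (simp only: prob_Z prob_V mult_ac)
  qed
  \<comment> \<open>The next state is split by the operator values \<open>(k, s)\<close>.
    Innovations are nonnegative, so \<open>k\<close> and \<open>s\<close> are at most
    \<open>y1\<close> and \<open>y2\<close>, and in this range the truncated subtractions are
    exact.\<close>
  have "{\<omega> \<in> space M. ?P \<omega> \<in> A \<and> pair_proc X t \<omega> = (y1, y2)} = (\<Union>z\<in>{0..y1} \<times> {0..y2}. E z)"
  proof (intro set_eqI)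
    fix \<omega>
    obtain k s where V: "V \<omega> = ((k, s), ?P \<omega>)"
      by (simp add: V_def)
    then have "pair_proc X t \<omega> = (k + Z 1 t \<omega>, s + Z 2 t \<omega>)" if "\<omega> \<in> space M"
      using that t by (simp add: V_def pair_proc_def X_rec)
    moreover have "\<omega> \<in> E (k', s') \<longleftrightarrow> \<omega> \<in> space M \<and> ?P \<omega> \<in> A \<and> k' = k \<and> s' = s \<and>
        Z 1 t \<omega> = y1 - k \<and> Z 2 t \<omega> = y2 - s" for k' s'
      by (auto simp: E_def V pair_proc_def)
    ultimately show "\<omega> \<in> {\<omega> \<in> space M. ?P \<omega> \<in> A \<and> pair_proc X t \<omega> = (y1, y2)} \<longleftrightarrow>
        \<omega> \<in> (\<Union>z\<in>{0..y1} \<times> {0..y2}. E z)"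
      by (cases "\<omega> \<in> space M") auto
  qed
  also have "prob \<dots> = (\<Sum>z\<in>{0..y1} \<times> {0..y2}. prob (E z))"
  proof (rule finite_measure_finite_Union)
    show "E ` ({0..y1} \<times> {0..y2}) \<subseteq> events"
      using E_events by auto
    show "disjoint_family_on E ({0..y1} \<times> {0..y2})"
      unfolding disjoint_family_on_def E_def by fastforce
  qed simp
  also have "\<dots> = (\<Sum>(k, s)\<in>{0..y1} \<times> {0..y2}. prob {\<omega> \<in> space M. ?P \<omega> \<in> A} *
      (pmf fZ (y1 - k, y2 - s) * nb_mix (m 1) l x1 k * nb_mix (m 2) l x2 s))"
    by (intro sum.cong refl) (simp only: split_paired_all prob_E prod.case)
  also have "\<dots> = prob {\<omega> \<in> space M. ?P \<omega> \<in> A} *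
    (\<Sum>k = 0..y1. \<Sum>s = 0..y2. pmf fZ (y1 - k, y2 - s) * nb_mix (m 1) l x1 k * nb_mix (m 2) l x2 s)"
    by (simp add: sum.cartesian_product sum_distrib_left split_beta)
  finally show ?thesis .
qed

section \<open>Transition probabilities and the Markov property\<close>

lemma pair_proc_measurable: "pair_proc X t \<in> measurable M (count_space UNIV)"
proof -
  have "(\<lambda>\<omega>. (X 1 t \<omega>, X 2 t \<omega>)) \<in> measurable M (count_space UNIV \<Otimes>\<^sub>M count_space UNIV)"
    using X_measurable by (intro measurable_Pair) auto
  then show ?thesis
    by (simp add: pair_measure_countable pair_proc_def[abs_def])
qed

lemma transition_prob:
  assumes t: "t \<ge> 1" and "prob {\<omega> \<in> space M. pair_proc X (t - 1) \<omega> = (x1, x2)} > 0"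
  shows "\<P>(\<omega> in M. pair_proc X t \<omega> = (y1, y2) \<bar> pair_proc X (t - 1) \<omega> = (x1, x2)) =
    (\<Sum>k = 0..y1. \<Sum>s = 0..y2. pmf fZ (y1 - k, y2 - s) * nb_mix (m 1) l x1 k * nb_mix (m 2) l x2 s)"
proof -
  \<comment> \<open>The cylinder that fixes only the last coordinate; \<open>t - 1\<close> is an
    index of the past because \<open>t\<close> is at least 1.\<close>
  let ?A = "{f \<in> space (Pi\<^sub>M {..<t} (\<lambda>_. count_space UNIV)). f (t - 1) = (x1, x2)}"
  have "?A \<in> sets (Pi\<^sub>M {..<t} (\<lambda>_. count_space UNIV))"
    using t by (intro measurable_sets_Collect[OF measurable_component_singleton, where P = "\<lambda>z. z = (x1, x2)"]) auto
  moreover have "past (pair_proc X) t \<omega> \<in> ?A \<longleftrightarrow> pair_proc X (t - 1) \<omega> = (x1, x2)" for \<omega>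
    using t by (auto simp: past_def space_PiM)
  ultimately show ?thesis
    using transition_on_past[OF t, of ?A x1 x2 y1 y2] assms(2)
    by (simp add: cond_prob_def conj_commute)
qed

lemma transition_prob_past:
  assumes t: "t \<ge> 1" and last: "x (t - 1) = (x1, x2)" and "prob {\<omega> \<in> space M. \<forall>s<t. pair_proc X s \<omega> = x s} > 0"
  shows "\<P>(\<omega> in M. pair_proc X t \<omega> = (y1, y2) \<bar> \<forall>s<t. pair_proc X s \<omega> = x s) =
    (\<Sum>k = 0..y1. \<Sum>s = 0..y2. pmf fZ (y1 - k, y2 - s) * nb_mix (m 1) l x1 k * nb_mix (m 2) l x2 s)"
proof -
  \<comment> \<open>A single path, written as a finite product of singletons to make it
    measurable.\<close>
  let ?A = "Pi\<^sub>E {..<t} (\<lambda>s. {x s})"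
  have "?A \<in> sets (Pi\<^sub>M {..<t} (\<lambda>_. count_space UNIV))"
    by (intro sets_PiM_I_finite) auto
  moreover have "past (pair_proc X) t \<omega> \<in> ?A \<longleftrightarrow> (\<forall>s<t. pair_proc X s \<omega> = x s)" for \<omega>
    by (auto simp: past_def PiE_iff)
  moreover have "f (t - 1) = (x1, x2)" if "f \<in> ?A" for f
    using that t last by (auto simp: PiE_iff)
  ultimately show ?thesis
    using transition_on_past[OF t, of ?A x1 x2 y1 y2] assms(3)
    by (simp add: cond_prob_def conj_commute)
qed

lemma markov: "markov_process M (pair_proc X)"
  unfolding markov_process_def
proof (intro conjI allI impI pair_proc_measurable)
  fix t :: nat and x :: "nat \<Rightarrow> nat \<times> nat" and y :: "nat \<times> nat"
  assume t: "t \<ge> 1" and pos: "prob {\<omega> \<in> space M. \<forall>s<t. pair_proc X s \<omega> = x s} > 0"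
  obtain x1 x2 y1 y2 where xy: "x (t - 1) = (x1, x2)" "y = (y1, y2)"
    by (metis surj_pair)
  \<comment> \<open>The path event lies inside the last-state event, so both conditionings have
    positive probability and both formulas apply.\<close>
  have "prob {\<omega> \<in> space M. \<forall>s<t. pair_proc X s \<omega> = x s} \<le> prob {\<omega> \<in> space M. pair_proc X (t - 1) \<omega> = x (t - 1)}"
    using t pair_proc_measurable[of "t - 1"] by (intro finite_measure_mono) auto
  with pos have "prob {\<omega> \<in> space M. pair_proc X (t - 1) \<omega> = x (t - 1)} > 0"
    by linarith
  then show "\<P>(\<omega> in M. pair_proc X t \<omega> = y \<bar> \<forall>s<t. pair_proc X s \<omega> = x s) =
      \<P>(\<omega> in M. pair_proc X t \<omega> = y \<bar> pair_proc X (t - 1) \<omega> = x (t - 1))"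
    using transition_prob[OF t, of x1 x2 y1 y2] transition_prob_past[OF t xy(1) pos, of y1 y2]
    unfolding xy by simp
qed

end

theorem proposition2p1:
  fixes M :: "'a measure"
    and m :: "nat \<Rightarrow> real" and l :: real
    and \<mu> \<sigma>Z :: "nat \<Rightarrow> real" and \<phi> :: real
    and fZ :: "(nat \<times> nat) pmf"
    and \<alpha> :: "nat \<Rightarrow> nat \<Rightarrow> 'a \<Rightarrow> real"
    and G :: "nat \<Rightarrow> nat \<Rightarrow> nat \<Rightarrow> 'a \<Rightarrow> nat"
    and Z X :: "nat \<Rightarrow> nat \<Rightarrow> 'a \<Rightarrow> nat"
  assumes "brcmnbinar1 M m l \<mu> \<sigma>Z \<phi> fZ \<alpha> G Z X"
  shows "markov_process M (pair_proc X) \<and>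
    (\<forall>t\<ge>1. \<forall>x1 x2 y1 y2 :: nat.
       \<P>(\<omega> in M. pair_proc X (t - 1) \<omega> = (x1, x2)) > 0 \<longrightarrow>
       \<P>(\<omega> in M. pair_proc X t \<omega> = (y1, y2) \<bar> pair_proc X (t - 1) \<omega> = (x1, x2)) =
       (\<Sum>k=0..y1. \<Sum>s=0..y2.
          pmf fZ (y1 - k, y2 - s)
          * (real ((x1 + k) choose k)
             * (Gamma (real x1 + l + 2) * Gamma (real k + m 1) * Gamma (l + m 1 + 1)
                / (Gamma (real x1 + real k + m 1 + l + 2) * Gamma (l + 1) * Gamma (m 1))))
          * (real ((x2 + s) choose s)
             * (Gamma (real x2 + l + 2) * Gamma (real s + m 2) * Gamma (l + m 2 + 1)
                / (Gamma (real x2 + real s + m 2 + l + 2) * Gamma (l + 1) * Gamma (m 2))))))"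
proof -
  interpret brcmnbinar1 M m l \<mu> \<sigma>Z \<phi> fZ \<alpha> G Z X
    by (rule assms)
  show ?thesis
    using markov transition_prob by (simp add: nb_mix_def)
qed

end
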